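(* Let $\alpha\in\mathbb{R}$ and let $F$ be the Freund $4$-manifold with coordinates $(\alpha_1,\beta_1,\alpha_2,\beta_2)\in(0,\infty)^4$. The $\alpha$-Ricci tensor $R^{(\alpha)}=[R^{(\alpha)}_{jk}]$ of $F$ is given by $$[R^{(\alpha)}_{jk}]=\begin{pmatrix}\frac{-(\alpha^2-1)\alpha_2}{2\alpha_1(\alpha_1+\alpha_2)^2}&0&\frac{\alpha^2-1}{2(\alpha_1+\alpha_2)^2}&0\\0&\frac{-(\alpha^2-1)\alpha_2}{2(\alpha_1+\alpha_2)\beta_1^2}&0&0\\\frac{\alpha^2-1}{2(\alpha_1+\alpha_2)^2}&0&\frac{-(\alpha^2-1)\alpha_1}{2\alpha_2(\alpha_1+\alpha_2)^2}&0\\0&0&0&\frac{-(\alpha^2-1)\alpha_1}{2(\alpha_1+\alpha_2)\beta_2^2}\end{pmatrix}.$$ The eigenvalues of this matrix are $$0,\quad (\alpha^2-1)\Big(\frac{1}{(\alpha_1+\alpha_2)^2}-\frac{1}{2\alpha_1\alpha_2}\Big),\quad (\alpha^2-1)\frac{-\alpha_2}{2(\alpha_1+\alpha_2)\beta_1^2},\quad (\alpha^2-1)\frac{-\alpha_1}{2(\alpha_1+\alpha_2)\beta_2^2},$$ with corresponding eigenvectors, in the same order, $$\Big(\frac{\alpha_1}{\alpha_2},0,1,0\Big),\quad \Big(-\frac{\alpha_2}{\alpha_1},0,1,0\Big),\quad (0,1,0,0),\quad (0,0,0,1).$$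
   Context: The Freund $4$-manifold $F$ is the family of densities on $(0,\infty)^2$ $$f(x,y;\alpha_1,\beta_1,\alpha_2,\beta_2)=\begin{cases}\alpha_1\beta_2\,e^{-\beta_2 y-(\alpha_1+\alpha_2-\beta_2)x} & 0< x<y,\\ \alpha_2\beta_1\,e^{-\beta_1 x-(\alpha_1+\alpha_2-\beta_1)y} & 0<y\le x,\end{cases}\qquad \alpha_i,\beta_i>0,$$ with coordinates $(x_1,x_2,x_3,x_4)=(\alpha_1,\beta_1,\alpha_2,\beta_2)$ and the Fisher information metric $g_{ij}=-\int_0^\infty\int_0^\infty \frac{\partial^2\log f}{\partial x_i\partial x_j}f\,dx\,dy$. The subscripted $\alpha_1,\alpha_2$ are coordinates, unrelated to the real number $\alpha$. With $\partial_i=\partial/\partial x_i$, the $\alpha$-connection $\nabla^{(\alpha)}$ is the torsion-free affine connection with $g(\nabla^{(\alpha)}_{\partial_i}\partial_j,\partial_k)=\Gamma^{(\alpha)}_{ij,k}$, where $$\Gamma^{(\alpha)}_{ij,k}=\int_0^\infty\!\!\int_0^\infty\Big(\partial_i\partial_j\log f\;\partial_k\log f+\tfrac{1-\alpha}{2}\,\partial_i\log f\,\partial_j\log f\,\partial_k\log f\Big)f\,dx\,dy.$$ The $\alpha$-curvature tensor is the curvature of $\nabla^{(\alpha)}$, $R(X,Y)Z=\nabla_X\nabla_YZ-\nabla_Y\nabla_XZ-\nabla_{[X,Y]}Z$, with components $R^{(\alpha)}_{ijkl}=g(R(\partial_i,\partial_j)\partial_k,\partial_l)$. The $\alpha$-Ricci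 tensor is the contraction $R^{(\alpha)}_{jk}=\sum_{i,l}g^{il}R^{(\alpha)}_{ijkl}$, where $[g^{ij}]=[g_{ij}]^{-1}$. Eigenvalues and eigenvectors are those of the $4\times4$ coordinate matrix $[R^{(\alpha)}_{jk}]$. *)

theory Defs
  imports "HOL-Analysis.Analysis" "HOL-Computational_Algebra.Polynomial"
begin

section \<open>The Freund family\<close>

text \<open>
  A parameter \<open>p :: real^4\<close> stands for \<open>(\<alpha>\<^sub>1, \<beta>\<^sub>1, \<alpha>\<^sub>2, \<beta>\<^sub>2)\<close>. The manifold is the open orthant of
  positive parameters. The functions below are total on \<open>real^4\<close>, but at a point of the orthant
  they depend only on their arguments near that point, so the values elsewhere are irrelevant.
\<close>

definition freund_density :: "real^4 \<Rightarrow> real \<Rightarrow> real \<Rightarrow> real" where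
  "freund_density p x y =
    (if 0 < x \<and> x < y then p$1 * p$4 * exp (- p$4 * y - (p$1 + p$3 - p$4) * x)
     else if 0 < y \<and> y \<le> x then p$3 * p$2 * exp (- p$2 * x - (p$1 + p$3 - p$2) * y)
     else 0)"

definition log_density :: "real \<Rightarrow> real \<Rightarrow> real^4 \<Rightarrow> real" where
  "log_density x y p = ln (freund_density p x y)"

definition expect :: "real^4 \<Rightarrow> (real \<Rightarrow> real \<Rightarrow> real) \<Rightarrow> real" where
  "expect p h = (LINT y:{0<..}|lborel. (LINT x:{0<..}|lborel. h x y * freund_density p x y))"

definition partial :: "4 \<Rightarrow> (real^4 \<Rightarrow> real) \<Rightarrow> real^4 \<Rightarrow> real" where
  "partial i F p = deriv (\<lambda>t. F (p + t *\<^sub>R axis i 1)) 0"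

definition fisher_metric :: "real^4 \<Rightarrow> real^4^4" where
  "fisher_metric p =
    (\<chi> i j. - expect p (\<lambda>x y. partial i (partial j (log_density x y)) p))"

definition metric_form :: "real^4 \<Rightarrow> real^4 \<Rightarrow> real^4 \<Rightarrow> real" where
  "metric_form p u v = u \<bullet> (fisher_metric p *v v)"


section \<open>The \<open>\<alpha>\<close>-connection and its curvature\<close>

definition Gamma_lower :: "real \<Rightarrow> real^4 \<Rightarrow> 4 \<Rightarrow> 4 \<Rightarrow> 4 \<Rightarrow> real" where
  "Gamma_lower \<alpha> p i j k = expect p (\<lambda>x y.
     partial i (partial j (log_density x y)) p * partial k (log_density x y) p
     + (1 - \<alpha>) / 2 * (partial i (log_density x y) p * partial j (log_density x y) p
                      * partial k (log_density x y) p))"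

definition Gamma_upper :: "real \<Rightarrow> real^4 \<Rightarrow> 4 \<Rightarrow> 4 \<Rightarrow> 4 \<Rightarrow> real" where
  "Gamma_upper \<alpha> p m i j =
     (\<Sum>k\<in>UNIV. matrix_inv (fisher_metric p) $ m $ k * Gamma_lower \<alpha> p i j k)"

text \<open>A vector field is given by its components with respect to the coordinate frame.\<close>

type_synonym vfield = "real^4 \<Rightarrow> real^4"

definition coord_field :: "4 \<Rightarrow> vfield" where
  "coord_field i = (\<lambda>_. axis i 1)"

definition dir_deriv :: "vfield \<Rightarrow> (real^4 \<Rightarrow> real) \<Rightarrow> real^4 \<Rightarrow> real" where
  "dir_deriv X F p = (\<Sum>i\<in>UNIV. X p $ i * partial i F p)"

definition lie_bracket :: "vfield \<Rightarrow> vfield \<Rightarrow> vfield" where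
  "lie_bracket X Y p =
     (\<chi> m. dir_deriv X (\<lambda>q. Y q $ m) p - dir_deriv Y (\<lambda>q. X q $ m) p)"

definition cov_deriv :: "real \<Rightarrow> vfield \<Rightarrow> vfield \<Rightarrow> vfield" where
  "cov_deriv \<alpha> X Y p =
     (\<chi> m. dir_deriv X (\<lambda>q. Y q $ m) p
           + (\<Sum>i\<in>UNIV. \<Sum>j\<in>UNIV. X p $ i * Y p $ j * Gamma_upper \<alpha> p m i j))"

definition curvature :: "real \<Rightarrow> vfield \<Rightarrow> vfield \<Rightarrow> vfield \<Rightarrow> vfield" where
  "curvature \<alpha> X Y Z p =
     cov_deriv \<alpha> X (cov_deriv \<alpha> Y Z) p - cov_deriv \<alpha> Y (cov_deriv \<alpha> X Z) p
     - cov_deriv \<alpha> (lie_bracket X Y) Z p"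

definition curvature_comp :: "real \<Rightarrow> real^4 \<Rightarrow> 4 \<Rightarrow> 4 \<Rightarrow> 4 \<Rightarrow> 4 \<Rightarrow> real" where
  "curvature_comp \<alpha> p i j k l =
     metric_form p (curvature \<alpha> (coord_field i) (coord_field j) (coord_field k) p)
       (coord_field l p)"

definition alpha_ricci :: "real \<Rightarrow> real^4 \<Rightarrow> real^4^4" where
  "alpha_ricci \<alpha> p = (\<chi> j k. \<Sum>i\<in>UNIV. \<Sum>l\<in>UNIV.
     matrix_inv (fisher_metric p) $ i $ l * curvature_comp \<alpha> p i j k l)"

text \<open>
  Where the metric is nondegenerate, \<open>cov_deriv\<close> satisfies the defining equation of the
  \<open>\<alpha>\<close>-connection on the coordinate fields.
\<close>

lemma cov_deriv_coord_field:
  "cov_deriv \<alpha> (coord_field i) (coord_field j) p = (\<chi> m. Gamma_upper \<alpha> p m i j)"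
proof -
  have "dir_deriv (coord_field i) (\<lambda>q. coord_field j q $ m) p = 0" for m
    by (simp add: dir_deriv_def coord_field_def partial_def)
  moreover have "(\<Sum>a\<in>UNIV. \<Sum>b\<in>UNIV. (if a = i then if b = j then (c :: 4 \<Rightarrow> 4 \<Rightarrow> real) a b else 0 else 0)) = c i j" for c
    by (simp add: if_distrib [of "sum _"] sum.If_cases sum.delta)
  ultimately show ?thesis
    by (simp add: cov_deriv_def coord_field_def axis_def vec_eq_iff if_distrib [of "\<lambda>c. c * _"]
        cong: if_cong)
qed

lemma metric_form_cov_deriv_coord_field:
  assumes "invertible (fisher_metric p)" "transpose (fisher_metric p) = fisher_metric p"
  shows "metric_form p (cov_deriv \<alpha> (coord_field i) (coord_field j) p) (coord_field k p)
         = Gamma_lower \<alpha> p i j k"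
proof -
  let ?g = "fisher_metric p"
  let ?G = "\<chi> k. Gamma_lower \<alpha> p i j k"
  have up: "cov_deriv \<alpha> (coord_field i) (coord_field j) p = matrix_inv ?g *v ?G"
    by (simp add: cov_deriv_coord_field Gamma_upper_def matrix_vector_mult_def)
  have "metric_form p (matrix_inv ?g *v ?G) (axis k 1)
        = (?g *v (matrix_inv ?g *v ?G)) \<bullet> axis k 1"
    unfolding metric_form_def by (metis assms(2) dot_lmul_matrix transpose_matrix_vector)
  also have "?g *v (matrix_inv ?g *v ?G) = ?G"
    using assms(1) unfolding invertible_def matrix_inv_def
    by (metis (mono_tags, lifting) matrix_vector_mul_assoc matrix_vector_mul_lid someI_ex)
  finally show ?thesis
    unfolding up by (simp add: coord_field_def inner_axis)
qed


section \<open>Eigenvalues\<close>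

definition eigenvector :: "real^'n^'n \<Rightarrow> real^'n \<Rightarrow> real \<Rightarrow> bool" where
  "eigenvector A v c \<longleftrightarrow> v \<noteq> 0 \<and> A *v v = c *\<^sub>R v"

definition eigenvalue :: "real^'n^'n \<Rightarrow> real \<Rightarrow> bool" where
  "eigenvalue A c \<longleftrightarrow> (\<exists>v. eigenvector A v c)"

definition char_poly :: "real^'n^'n \<Rightarrow> real poly" where
  "char_poly A = det (mat [:0, 1:] - (\<chi> i j. [:A $ i $ j:]))"

end

theory Submission
  imports Defs "HOL-Probability.Distributions"
begin

text \<open>
  Under the Freund distribution the event \<open>x < y\<close> has probability \<open>\<alpha>\<^sub>1 / (\<alpha>\<^sub>1 + \<alpha>\<^sub>2)\<close>; given this event,
  or its complement, \<open>min x y\<close> is exponential of rate \<open>\<alpha>\<^sub>1 + \<alpha>\<^sub>2\<close> and \<open>\<bar>x - y\<bar>\<close> is an independent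
  exponential variable of rate \<open>\<beta>\<^sub>2\<close>, respectively \<open>\<beta>\<^sub>1\<close>. On either event every score is a polynomial in one
  of these two variables, so the metric and the connection reduce to moments of
  exponential distributions. The metric is diagonal; hence the Ricci tensor is the plain
  trace of the curvature written in Christoffel symbols, which are rational functions.
\<close>

section \<open>Moments of the Freund distribution\<close>

text \<open>The mean of \<open>P\<close> at an exponential variable of rate \<open>l\<close>, whose
  \<open>i\<close>-th moment is \<open>fact i / l ^ i\<close>. The algebraic form turns every later
  expectation into a rational expression.\<close>

definition exp_mean :: "real \<Rightarrow> real poly \<Rightarrow> real" where
  "exp_mean l P = (\<Sum>i\<le>degree P. coeff P i * (fact i / l ^ i))"

text \<open>The degree drops when leading coefficients vanish, so evaluation goes through a fixed
  upper bound.\<close>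

lemma exp_mean_eq_sum:
  assumes "degree P \<le> n"
  shows "exp_mean l P = (\<Sum>i\<le>n. coeff P i * (fact i / l ^ i))"
  unfolding exp_mean_def
  by (rule sum.mono_neutral_left) (use assms in \<open>auto simp: coeff_eq_0\<close>)

text \<open>Degree three suffices: \<open>Gamma_lower\<close> involves products of at most three
  scores, each of degree at most one in either variable.\<close>

lemma exp_mean_cubic:
  "exp_mean l [:c0, c1, c2, c3:] = c0 + c1 / l + 2 * c2 / l ^ 2 + 6 * c3 / l ^ 3"
proof -
  have "degree [:c0, c1, c2, c3:] \<le> 3"
    by (simp add: degree_pCons_le order_trans[OF degree_pCons_le])
  from exp_mean_eq_sum[OF this] show ?thesis
    by (simp add: eval_nat_numeral fact_numeral mult.commute)
qed

lemma exp_mean_simps: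
  "exp_mean l 0 = 0"
  "exp_mean l 1 = 1"
  "exp_mean l [:c0:] = c0"
  "exp_mean l [:c0, c1:] = c0 + c1 / l"
  "exp_mean l [:c0, c1, c2:] = c0 + c1 / l + 2 * c2 / l ^ 2"
  using exp_mean_cubic[of l 0 0 0 0] exp_mean_cubic[of l c0 0 0 0] exp_mean_cubic[of l 1 0 0 0]
    exp_mean_cubic[of l c0 c1 0 0] exp_mean_cubic[of l c0 c1 c2 0]
  by (simp_all add: one_pCons)

lemma has_bochner_integral_power_exp:
  fixes l :: real
  assumes l: "0 < l"
  shows "has_bochner_integral lborel (\<lambda>x. indicator {0..} x * (x ^ i * (l * exp (- l * x)))) (fact i / l ^ i)"
proof (rule has_bochner_integral_nn_integral)
  have "indicator {0..} x * (x ^ i * (l * exp (- l * x))) = erlang_density 0 l x * x ^ i" for x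
    by (simp add: erlang_density_def indicator_def)
  then show "(\<integral>\<^sup>+x. ennreal (indicator {0..} x * (x ^ i * (l * exp (- l * x)))) \<partial>lborel) = ennreal (fact i / l ^ i)"
    using nn_integral_erlang_ith_moment[OF l, of 0 i] by (simp only: fact_0 mult_1_left add_0)
qed (use l in \<open>auto simp: indicator_def\<close>)

text \<open>The set is a parameter because the distance ranges over \<open>{0<..}\<close> on
  \<open>x < y\<close> but over \<open>{0..}\<close> on \<open>y \<le> x\<close>.\<close>

definition exp_weight :: "real set \<Rightarrow> real \<Rightarrow> real poly \<Rightarrow> real \<Rightarrow> real" where
  "exp_weight S l P x = indicator S x * (poly P x * (l * exp (- l * x)))"

lemma has_bochner_integral_exp_weight_atLeast:
  assumes "0 < l"
  shows "has_bochner_integral lborel (exp_weight {0..} l P) (exp_mean l P)"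
proof -
  have "has_bochner_integral lborel
      (\<lambda>x. \<Sum>i\<le>degree P. coeff P i * (indicator {0..} x * (x ^ i * (l * exp (- l * x)))))
      (\<Sum>i\<le>degree P. coeff P i * (fact i / l ^ i))"
    by (intro has_bochner_integral_sum has_bochner_integral_mult_right
        has_bochner_integral_power_exp assms)
  also have "(\<lambda>x. \<Sum>i\<le>degree P. coeff P i * (indicator {0..} x * (x ^ i * (l * exp (- l * x)))))
      = exp_weight {0..} l P"
    by (auto simp: exp_weight_def fun_eq_iff poly_altdef sum_distrib_left sum_distrib_right mult_ac)
  finally show ?thesis unfolding exp_mean_def .
qed

lemma has_bochner_integral_exp_weight_greaterThan:
  assumes "0 < l"
  shows "has_bochner_integral lborel (exp_weight {0<..} l P) (exp_mean l P)"
proof -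
  have "has_bochner_integral lborel (exp_weight {0<..} l P) (exp_mean l P) \<longleftrightarrow>
        has_bochner_integral lborel (exp_weight {0..} l P) (exp_mean l P)"
    by (rule has_bochner_integral_discrete_difference[of "{0}"])
      (auto simp: exp_weight_def indicator_def)
  then show ?thesis
    using has_bochner_integral_exp_weight_atLeast[OF assms] by simp
qed

text \<open>The shear \<open>(x, y)\<close> to \<open>(x, y - x)\<close> preserves Lebesgue measure;
  by Fubini this comes down to translation invariance of the inner integral. The second form follows
  by exchanging the coordinates.\<close>

lemma has_bochner_integral_shear:
  fixes \<phi> \<psi> :: "real \<Rightarrow> real"
  assumes \<phi>: "has_bochner_integral lborel \<phi> u" and \<psi>: "has_bochner_integral lborel \<psi> v"
  shows "has_bochner_integral (lborel \<Otimes>\<^sub>M lborel) (\<lambda>(x, y). \<phi> x * \<psi> (y - x)) (u * v)"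
    and "has_bochner_integral (lborel \<Otimes>\<^sub>M lborel) (\<lambda>(x, y). \<phi> y * \<psi> (x - y)) (u * v)"
proof -
  have [measurable]: "\<phi> \<in> borel_measurable borel" "\<psi> \<in> borel_measurable borel"
    using \<phi> \<psi> by (auto simp: has_bochner_integral_iff dest: borel_measurable_integrable)
  have shift: "has_bochner_integral lborel (\<lambda>y. h (y - x)) w"
    if "has_bochner_integral lborel h w" for h :: "real \<Rightarrow> real" and w x
    using that lborel_has_bochner_integral_real_affine_iff[of 1 h w "- x"] by simp
  have slice: "has_bochner_integral lborel (\<lambda>y. \<phi> x * \<psi> (y - x)) (\<phi> x * v)" for x
    by (intro has_bochner_integral_mult_right shift \<psi>)
  \<comment> \<open>Fubini's integrability criterion asks that the inner integrals of the absolute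
    value be integrable in \<open>x\<close>.\<close>
  have slice_norm: "has_bochner_integral lborel (\<lambda>y. \<bar>\<phi> x * \<psi> (y - x)\<bar>)
      (\<bar>\<phi> x\<bar> * (\<integral>y. \<bar>\<psi> y\<bar> \<partial>lborel))" for x
    unfolding abs_mult
    by (intro has_bochner_integral_mult_right shift has_bochner_integral_integrable integrable_abs)
      (use \<psi> in \<open>simp add: has_bochner_integral_iff\<close>)
  have int: "integrable (lborel \<Otimes>\<^sub>M lborel) (\<lambda>(x, y). \<phi> x * \<psi> (y - x))"
    by (rule lborel_pair.Fubini_integrable)
      (use \<phi> slice in \<open>auto simp: has_bochner_integral_integral_eq[OF slice_norm] has_bochner_integral_iff
         intro!: integrable_mult_left\<close>)
  have "integral\<^sup>L (lborel \<Otimes>\<^sub>M lborel) (\<lambda>(x, y). \<phi> x * \<psi> (y - x)) = (\<integral>x. \<phi> x * v \<partial>lborel)"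
    using lborel_pair.integral_fst'[OF int]
    by (simp add: has_bochner_integral_integral_eq[OF slice] del: integral_mult_right_zero)
  also have "\<dots> = u * v"
    using \<phi> by (simp add: has_bochner_integral_iff)
  finally show 1: "has_bochner_integral (lborel \<Otimes>\<^sub>M lborel) (\<lambda>(x, y). \<phi> x * \<psi> (y - x)) (u * v)"
    using int by (simp add: has_bochner_integral_iff)
  show "has_bochner_integral (lborel \<Otimes>\<^sub>M lborel) (\<lambda>(x, y). \<phi> y * \<psi> (x - y)) (u * v)"
    using 1 lborel_pair.integrable_product_swap[OF int]
      lborel_pair.integral_product_swap[of "\<lambda>(x, y). \<phi> x * \<psi> (y - x)"]
    by (simp add: has_bochner_integral_iff)
qed

text \<open>Unlike \<open>expect\<close>, this includes integrability on the plane, so values can be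
  added and Fubini's theorem applies.\<close>

definition has_expect :: "real^4 \<Rightarrow> (real \<Rightarrow> real \<Rightarrow> real) \<Rightarrow> real \<Rightarrow> bool" where
  "has_expect p h v \<longleftrightarrow> has_bochner_integral (lborel \<Otimes>\<^sub>M lborel)
     (\<lambda>(x, y). indicator {0<..} x * indicator {0<..} y * (h x y * freund_density p x y)) v"

lemma expect_eqI:
  assumes "has_expect p h v"
  shows "expect p h = v"
proof -
  have "(\<integral>y. (\<integral>x. indicator {0<..} x * indicator {0<..} y * (h x y * freund_density p x y) \<partial>lborel) \<partial>lborel) = v"
    using assms lborel_pair.integral_snd
      [of "\<lambda>x y. indicator {0<..} x * indicator {0<..} y * (h x y * freund_density p x y)"]
    by (simp add: has_expect_def has_bochner_integral_iff)
  also have "(\<lambda>y. \<integral>x. indicator {0<..} x * indicator {0<..} y * (h x y * freund_density p x y) \<partial>lborel)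
     = (\<lambda>y. indicator {0<..} y * (\<integral>x. indicator {0<..} x * (h x y * freund_density p x y) \<partial>lborel))"
    by (auto simp: fun_eq_iff indicator_def)
  finally show ?thesis
    by (simp add: expect_def set_lebesgue_integral_def)
qed

lemma has_expect_add:
  assumes "has_expect p h v" "has_expect p k w"
  shows "has_expect p (\<lambda>x y. h x y + k x y) (v + w)"
  using has_bochner_integral_add[OF assms[unfolded has_expect_def]]
  by (simp add: has_expect_def case_prod_unfold algebra_simps)

lemma has_expect_cmult:
  assumes "has_expect p h v"
  shows "has_expect p (\<lambda>x y. c * h x y) (c * v)"
  using has_bochner_integral_mult_right[OF assms[unfolded has_expect_def], of c]
  by (simp add: has_expect_def case_prod_unfold algebra_simps)

definition orthant :: "(real^4) set" where
  "orthant = {p. \<forall>i. 0 < p $ i}"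

text \<open>With \<open>s = p$1 + p$3\<close>, the density on \<open>x < y\<close> is
  \<open>p$1 / s\<close> times \<open>s * exp (- s * x)\<close> times
  \<open>p$4 * exp (- p$4 * (y - x))\<close>, and symmetrically on \<open>y \<le> x\<close>. Each
  region thus contributes its probability times a product of two exponential means.\<close>

lemma has_expect_regions:
  assumes p: "p \<in> orthant"
    and A: "\<And>x y. 0 < x \<Longrightarrow> x < y \<Longrightarrow> h x y = poly P x * poly Q (y - x)"
    and B: "\<And>x y. 0 < y \<Longrightarrow> y \<le> x \<Longrightarrow> h x y = poly P' y * poly Q' (x - y)"
  shows "has_expect p h
     (p$1 / (p$1 + p$3) * (exp_mean (p$1 + p$3) P * exp_mean (p$4) Q)
      + p$3 / (p$1 + p$3) * (exp_mean (p$1 + p$3) P' * exp_mean (p$2) Q'))"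
proof -
  define s where "s = p$1 + p$3"
  have pos: "p$1 > 0" "p$2 > 0" "p$3 > 0" "p$4 > 0" and s: "s > 0"
    using p by (auto simp: orthant_def s_def add_pos_pos)
  have "has_bochner_integral (lborel \<Otimes>\<^sub>M lborel)
     (\<lambda>z. p$1 / s * (case z of (x, y) \<Rightarrow> exp_weight {0<..} s P x * exp_weight {0<..} (p$4) Q (y - x))
        + p$3 / s * (case z of (x, y) \<Rightarrow> exp_weight {0<..} s P' y * exp_weight {0..} (p$2) Q' (x - y)))
     (p$1 / s * (exp_mean s P * exp_mean (p$4) Q) + p$3 / s * (exp_mean s P' * exp_mean (p$2) Q'))"
    by (intro has_bochner_integral_add has_bochner_integral_mult_right has_bochner_integral_shear
        has_bochner_integral_exp_weight_greaterThan has_bochner_integral_exp_weight_atLeast s pos)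
  also have "(\<lambda>z. p$1 / s * (case z of (x, y) \<Rightarrow> exp_weight {0<..} s P x * exp_weight {0<..} (p$4) Q (y - x))
        + p$3 / s * (case z of (x, y) \<Rightarrow> exp_weight {0<..} s P' y * exp_weight {0..} (p$2) Q' (x - y)))
    = (\<lambda>(x, y). indicator {0<..} x * indicator {0<..} y * (h x y * freund_density p x y))"
  proof (intro ext, clarify)
    fix x y :: real
    have "exp (- p$4 * y - (s - p$4) * x) = exp (- s * x) * exp (- p$4 * (y - x))"
      "exp (- p$2 * x - (s - p$2) * y) = exp (- s * y) * exp (- p$2 * (x - y))"
      by (simp_all flip: exp_add add: algebra_simps)
    then show "p$1 / s * (exp_weight {0<..} s P x * exp_weight {0<..} (p$4) Q (y - x))
        + p$3 / s * (exp_weight {0<..} s P' y * exp_weight {0..} (p$2) Q' (x - y))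
       = indicator {0<..} x * indicator {0<..} y * (h x y * freund_density p x y)"
      using A[of x y] B[of y x] s
      by (auto simp: freund_density_def exp_weight_def indicator_def field_simps simp flip: s_def)
  qed
  finally show ?thesis by (simp add: has_expect_def s_def)
qed


section \<open>Scores\<close>

lemma eventually_orthant:
  assumes "p \<in> orthant"
  shows "\<forall>\<^sub>F t in nhds 0. p + t *\<^sub>R axis i 1 \<in> orthant"
proof -
  have "\<forall>\<^sub>F t in nhds 0. 0 < (p + t *\<^sub>R axis i 1) $ k" for k
  proof -
    have "((\<lambda>t::real. (p + t *\<^sub>R axis i 1) $ k) \<longlongrightarrow> (p + 0 *\<^sub>R axis i 1) $ k) (nhds 0)"
      by (intro tendsto_intros filterlim_ident)
    moreover have "0 < p $ k" using assms by (simp add: orthant_def)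
    ultimately show ?thesis by (intro order_tendstoD(1)[of _ _ _ 0]) auto
  qed
  then show ?thesis unfolding orthant_def by (simp add: eventually_all_finite)
qed

text \<open>The orthant is open, so formulas valid only for positive parameters may be substituted
  under \<open>partial\<close>.\<close>

lemma partial_cong:
  assumes "p \<in> orthant" "\<And>q. q \<in> orthant \<Longrightarrow> F q = G q"
  shows "partial i F p = partial i G p"
  unfolding partial_def
  by (intro deriv_cong_ev eventually_mono[OF eventually_orthant[OF assms(1)]] assms(2) refl)

lemma partialI:
  assumes "((\<lambda>t. F (p + t *\<^sub>R axis i 1)) has_real_derivative D) (at 0)"
  shows "partial i F p = D"
  unfolding partial_def by (rule DERIV_imp_deriv[OF assms])

lemma vector_4 [simp]:
  "(vector [x, y, z, w] :: ('a::zero)^4) $ 1 = x"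
  "(vector [x, y, z, w] :: ('a::zero)^4) $ 2 = y"
  "(vector [x, y, z, w] :: ('a::zero)^4) $ 3 = z"
  "(vector [x, y, z, w] :: ('a::zero)^4) $ 4 = w"
  unfolding vector_def by simp_all

text \<open>
  The score in direction \<open>i\<close> is the product of \<open>score_min r p i\<close>, evaluated at the minimum, and
  \<open>score_diff r' p i\<close>, evaluated at the distance. Here \<open>r\<close>, \<open>r'\<close> are the indices of the two
  parameters that are factors of the density: 1, 4 on \<open>x < y\<close> and 3, 2 on \<open>y \<le> x\<close>.
\<close>

definition score_min :: "4 \<Rightarrow> real^4 \<Rightarrow> 4 \<Rightarrow> real poly" where
  "score_min r p i = (if i = r then [:1 / p$r, -1:] else if i = 1 \<or> i = 3 then [:0, -1:] else 1)"

definition score_diff :: "4 \<Rightarrow> real^4 \<Rightarrow> 4 \<Rightarrow> real poly" where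
  "score_diff r p i = (if i = r then [:1 / p$r, -1:] else if i = 1 \<or> i = 3 then 1 else 0)"

lemma log_density_less:
  assumes "q \<in> orthant" "0 < x" "x < y"
  shows "log_density x y q = ln (q$1) + ln (q$4) - q$4 * (y - x) - (q$1 + q$3) * x"
  using assms by (simp add: log_density_def freund_density_def orthant_def ln_mult_pos algebra_simps)

lemma log_density_ge:
  assumes "q \<in> orthant" "0 < y" "y \<le> x"
  shows "log_density x y q = ln (q$3) + ln (q$2) - q$2 * (x - y) - (q$1 + q$3) * y"
  using assms by (simp add: log_density_def freund_density_def orthant_def ln_mult_pos algebra_simps)

lemma score_less:
  assumes p: "p \<in> orthant" and xy: "0 < x" "x < y"
  shows "partial i (log_density x y) p = poly (score_min 1 p i) x * poly (score_diff 4 p i) (y - x)"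
proof -
  have "partial i (log_density x y) p
      = partial i (\<lambda>q. ln (q$1) + ln (q$4) - q$4 * (y - x) - (q$1 + q$3) * x) p"
    by (intro partial_cong p log_density_less xy)
  \<comment> \<open>Keeping the components of \<open>axis i 1\<close> symbolic covers all four
    directions with one differentiation; the case split on \<open>i\<close> comes
    afterwards.\<close>
  also have "\<dots> = (axis i 1 :: real^4)$1 / p$1 + (axis i 1 :: real^4)$4 / p$4
      - (axis i 1 :: real^4)$4 * (y - x) - ((axis i 1 :: real^4)$1 + (axis i 1 :: real^4)$3) * x"
    by (rule partialI)
      (use p in \<open>auto intro!: derivative_eq_intros simp: orthant_def\<close>)
  also have "\<dots> = poly (score_min 1 p i) x * poly (score_diff 4 p i) (y - x)"
    using exhaust_4[of i] by (auto simp: axis_def score_min_def score_diff_def)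
  finally show ?thesis .
qed

lemma score_ge:
  assumes p: "p \<in> orthant" and xy: "0 < y" "y \<le> x"
  shows "partial i (log_density x y) p = poly (score_min 3 p i) y * poly (score_diff 2 p i) (x - y)"
proof -
  have "partial i (log_density x y) p
      = partial i (\<lambda>q. ln (q$3) + ln (q$2) - q$2 * (x - y) - (q$1 + q$3) * y) p"
    by (intro partial_cong p log_density_ge xy)
  also have "\<dots> = (axis i 1 :: real^4)$3 / p$3 + (axis i 1 :: real^4)$2 / p$2
      - (axis i 1 :: real^4)$2 * (x - y) - ((axis i 1 :: real^4)$1 + (axis i 1 :: real^4)$3) * y"
    by (rule partialI)
      (use p in \<open>auto intro!: derivative_eq_intros simp: orthant_def\<close>)
  also have "\<dots> = poly (score_min 3 p i) y * poly (score_diff 2 p i) (x - y)"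
    using exhaust_4[of i] by (auto simp: axis_def score_min_def score_diff_def)
  finally show ?thesis .
qed

text \<open>Apart from the logarithms of its two prefactors the log density is linear in the
  parameters, so its Hessian on each region is diagonal and free of \<open>x\<close> and
  \<open>y\<close>.\<close>

definition score_hess :: "4 \<Rightarrow> 4 \<Rightarrow> real^4 \<Rightarrow> 4 \<Rightarrow> 4 \<Rightarrow> real" where
  "score_hess r r' p i j = (if i = j \<and> (i = r \<or> i = r') then - 1 / (p$i)\<^sup>2 else 0)"

text \<open>The two admissible pairs \<open>r\<close>, \<open>r'\<close> are the two regions;
  \<open>u\<close> and \<open>v\<close> stand for the minimum and the distance. At most one of the
  two factors varies with the parameters, and then only through the reciprocal of the
  \<open>j\<close>-th one.\<close>

lemma partial_score:
  assumes p: "p \<in> orthant" and r: "r = 1 \<and> r' = 4 \<or> r = 3 \<and> r' = 2"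
  shows "partial i (\<lambda>q. poly (score_min r q j) u * poly (score_diff r' q j) v) p = score_hess r r' p i j"
proof (rule partialI)
  have pos: "p $ k > 0" for k using p by (simp add: orthant_def)
  have inv: "((\<lambda>t. 1 / (p + t *\<^sub>R axis i 1) $ k - w) has_real_derivative
      (if i = k then - 1 / (p$k)\<^sup>2 else 0)) (at 0)" for k w
    using pos[of k]
    by (auto intro!: derivative_eq_intros simp: axis_def power2_eq_square)
  show "((\<lambda>t. poly (score_min r (p + t *\<^sub>R axis i 1) j) u * poly (score_diff r' (p + t *\<^sub>R axis i 1) j) v)
      has_real_derivative score_hess r r' p i j) (at 0)"
  proof -
    consider "j = r" | "j = r'" | "j \<noteq> r" "j \<noteq> r'" by blast
    then show ?thesis
    proof cases
      case 1
      then show ?thesis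
        using r inv[of r u]
        by (auto simp: score_min_def score_diff_def score_hess_def simp del: vector_add_component)
    next
      case 2
      then show ?thesis
        using r inv[of r' v]
        by (auto simp: score_min_def score_diff_def score_hess_def simp del: vector_add_component)
    next
      case 3
      then show ?thesis
        by (auto simp: score_min_def score_diff_def score_hess_def)
    qed
  qed
qed

lemma hess_less:
  assumes p: "p \<in> orthant" and xy: "0 < x" "x < y"
  shows "partial i (partial j (log_density x y)) p = score_hess 1 4 p i j"
  by (subst partial_score[symmetric, OF p, of _ _ _ _ x "y - x"])
    (auto intro!: partial_cong p score_less xy)

lemma hess_ge:
  assumes p: "p \<in> orthant" and xy: "0 < y" "y \<le> x"
  shows "partial i (partial j (log_density x y)) p = score_hess 3 2 p i j"
  by (subst partial_score[symmetric, OF p, of _ _ _ _ y "x - y"])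
    (auto intro!: partial_cong p score_ge xy)


section \<open>The Fisher metric and the Christoffel symbols\<close>

text \<open>Entry \<open>i\<close> is the probability of the region on which \<open>p$i\<close> is a
  factor of the density, divided by \<open>(p$i)\<^sup>2\<close>.\<close>

definition fisher_diag :: "real^4 \<Rightarrow> real^4" where
  "fisher_diag p = vector [1 / (p$1 * (p$1 + p$3)), p$3 / ((p$1 + p$3) * (p$2)\<^sup>2),
     1 / (p$3 * (p$1 + p$3)), p$1 / ((p$1 + p$3) * (p$4)\<^sup>2)]"

lemma fisher_metric_eq:
  assumes p: "p \<in> orthant"
  shows "fisher_metric p = (\<chi> i j. if i = j then fisher_diag p $ i else 0)"
proof -
  have pos: "p$1 > 0" "p$2 > 0" "p$3 > 0" "p$4 > 0" "p$1 + p$3 > 0" "p$1 + p$3 \<noteq> 0"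
    using p by (auto simp: orthant_def add_pos_pos intro!: less_imp_neq[symmetric])
  \<comment> \<open>Being constant on each region, the Hessian enters as a constant polynomial in
    the minimum times \<open>1\<close> in the distance.\<close>
  have "expect p (\<lambda>x y. partial i (partial j (log_density x y)) p)
    = p$1 / (p$1 + p$3) * (exp_mean (p$1 + p$3) [:score_hess 1 4 p i j:] * exp_mean (p$4) 1)
      + p$3 / (p$1 + p$3) * (exp_mean (p$1 + p$3) [:score_hess 3 2 p i j:] * exp_mean (p$2) 1)" for i j
    by (intro expect_eqI has_expect_regions p) (simp_all add: hess_less hess_ge p)
  then have "fisher_metric p $ i $ j = (if i = j then fisher_diag p $ i else 0)" for i j
    using pos exhaust_4[of i]
    by (auto simp: fisher_metric_def exp_mean_simps score_hess_def fisher_diag_def power2_eq_square)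
  then show ?thesis
    by (simp add: vec_eq_iff)
qed

text \<open>\<open>matrix_inv\<close> is a Hilbert choice; the witness \<open>B\<close> makes the
  chosen matrix a genuine inverse, and associativity identifies it with \<open>B\<close>.\<close>

lemma matrix_inv_unique:
  fixes A B :: "'a::semiring_1^'n^'n"
  assumes "A ** B = mat 1" "B ** A = mat 1"
  shows "matrix_inv A = B"
proof -
  have "A ** matrix_inv A = mat 1 \<and> matrix_inv A ** A = mat 1"
    unfolding matrix_inv_def by (rule someI[of _ B]) (use assms in simp)
  then have "(B ** A) ** matrix_inv A = B"
    by (simp flip: matrix_mul_assoc)
  then show ?thesis
    by (simp add: assms)
qed

lemma matrix_inv_diag:
  fixes d :: "real^'n"
  assumes "\<And>i. d $ i \<noteq> 0"
  shows "matrix_inv (\<chi> i j. if i = j then d $ i else 0) = (\<chi> i j. if i = j then 1 / d $ i else 0)"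
  by (rule matrix_inv_unique)
    (use assms in \<open>auto simp: vec_eq_iff matrix_matrix_mult_def mat_def if_distrib[of "\<lambda>c. c * _"] cong: if_cong\<close>)

lemma fisher_diag_pos:
  assumes "p \<in> orthant"
  shows "fisher_diag p $ i > 0"
proof -
  have "0 < p $ k" for k using assms by (simp add: orthant_def)
  then show ?thesis
    using exhaust_4[of i]
    by (auto simp: fisher_diag_def intro!: divide_pos_pos mult_pos_pos add_pos_pos zero_less_power)
qed

lemma matrix_inv_fisher_metric:
  assumes "p \<in> orthant"
  shows "matrix_inv (fisher_metric p) = (\<chi> i j. if i = j then 1 / fisher_diag p $ i else 0)"
  unfolding fisher_metric_eq[OF assms]
  by (rule matrix_inv_diag) (use fisher_diag_pos[OF assms] in \<open>simp add: less_imp_neq[symmetric]\<close>)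


text \<open>Products of scores multiply separately in the minimum and in the distance, so each
  region yields a product of two exponential means. The constant Hessian is absorbed into the first
  polynomial.\<close>

lemma Gamma_lower_eq:
  assumes p: "p \<in> orthant"
  shows "Gamma_lower \<alpha> p i j k =
    p$1 / (p$1 + p$3) *
      (exp_mean (p$1 + p$3) (smult (score_hess 1 4 p i j) (score_min 1 p k)) * exp_mean (p$4) (score_diff 4 p k))
    + p$3 / (p$1 + p$3) *
      (exp_mean (p$1 + p$3) (smult (score_hess 3 2 p i j) (score_min 3 p k)) * exp_mean (p$2) (score_diff 2 p k))
    + (1 - \<alpha>) / 2 *
    (p$1 / (p$1 + p$3) *
      (exp_mean (p$1 + p$3) (score_min 1 p i * score_min 1 p j * score_min 1 p k)
       * exp_mean (p$4) (score_diff 4 p i * score_diff 4 p j * score_diff 4 p k))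
    + p$3 / (p$1 + p$3) *
      (exp_mean (p$1 + p$3) (score_min 3 p i * score_min 3 p j * score_min 3 p k)
       * exp_mean (p$2) (score_diff 2 p i * score_diff 2 p j * score_diff 2 p k)))"
  unfolding Gamma_lower_def
  by (intro expect_eqI has_expect_add has_expect_cmult has_expect_regions p)
    (simp_all add: score_less score_ge hess_less hess_ge p)

text \<open>The outermost index is the upper one, and \<open>\<epsilon>\<close> stands for \<open>(1 - \<alpha>) / 2\<close>.\<close>

definition christoffel :: "real \<Rightarrow> real^4 \<Rightarrow> real^4^4^4" where
  "christoffel \<epsilon> p = (let a = p$1; b = p$2; c = p$3; d = p$4; s = p$1 + p$3 in vector [
     vector [
       vector [(1 - 3 * \<epsilon>) / s + (\<epsilon> - 1) / a, 0, - \<epsilon> / s, 0],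
       vector [0, (1 - \<epsilon>) * (a * c / (s * b\<^sup>2)), 0, 0],
       vector [- \<epsilon> / s, 0, (\<epsilon> - 1) / s + (1 - \<epsilon>) / c, 0],
       vector [0, 0, 0, (\<epsilon> - 1) * (a * c / (s * d\<^sup>2))]],
     vector [
       vector [0, - \<epsilon> / s, 0, 0],
       vector [- \<epsilon> / s, - (2 * \<epsilon>) / b, - \<epsilon> / s + \<epsilon> / c, 0],
       vector [0, - \<epsilon> / s + \<epsilon> / c, 0, 0],
       0],
     vector [
       vector [(\<epsilon> - 1) / s + (1 - \<epsilon>) / a, 0, - \<epsilon> / s, 0],
       vector [0, (\<epsilon> - 1) * (a * c / (s * b\<^sup>2)), 0, 0],
       vector [- \<epsilon> / s, 0, (1 - 3 * \<epsilon>) / s + (\<epsilon> - 1) / c, 0],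
       vector [0, 0, 0, (1 - \<epsilon>) * (a * c / (s * d\<^sup>2))]],
     vector [
       vector [0, 0, 0, - \<epsilon> / s + \<epsilon> / a],
       0,
       vector [0, 0, 0, - \<epsilon> / s],
       vector [- \<epsilon> / s + \<epsilon> / a, 0, - \<epsilon> / s, - (2 * \<epsilon>) / d]]])"

lemma Gamma_upper_eq:
  assumes p: "p \<in> orthant"
  shows "Gamma_upper \<alpha> p m i j = christoffel ((1 - \<alpha>) / 2) p $ m $ i $ j"
proof -
  define \<epsilon> where "\<epsilon> = (1 - \<alpha>) / 2"
  have pos: "p$1 > 0" "p$2 > 0" "p$3 > 0" "p$4 > 0" "p$1 + p$3 > 0"
    using p by (auto simp: orthant_def add_pos_pos)
  have nz: "p$1 \<noteq> 0" "p$2 \<noteq> 0" "p$3 \<noteq> 0" "p$4 \<noteq> 0" "p$1 + p$3 \<noteq> 0"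
    using pos by auto
  \<comment> \<open>The inverse metric is diagonal, so raising the index is division by a single
    entry.\<close>
  have "Gamma_upper \<alpha> p m i j = Gamma_lower \<alpha> p i j m / fisher_diag p $ m"
    by (simp add: Gamma_upper_def matrix_inv_fisher_metric[OF p] if_distrib[of "\<lambda>c. c * _"] cong: if_cong)
  \<comment> \<open>The 64 components become identities of rational functions, checked by clearing
    denominators.\<close>
  moreover have "\<forall>m i j. Gamma_lower \<alpha> p i j m / fisher_diag p $ m = christoffel \<epsilon> p $ m $ i $ j"
    unfolding forall_4 Gamma_lower_eq[OF p] \<epsilon>_def[symmetric]
    by (intro conjI;
      simp add: score_min_def score_diff_def score_hess_def exp_mean_simps exp_mean_cubic one_pCons
        christoffel_def Let_def fisher_diag_def nz;
      simp add: nz divide_simps power2_eq_square power3_eq_cube;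
      simp add: algebra_simps)
  ultimately show ?thesis by (simp add: \<epsilon>_def)
qed


section \<open>The Ricci tensor\<close>

lemma dir_deriv_coord_field: "dir_deriv (coord_field i) F p = partial i F p"
  by (simp add: dir_deriv_def coord_field_def axis_def if_distrib[of "\<lambda>c. c * _"] cong: if_cong)

lemma partial_const [simp]: "partial i (\<lambda>_. c) p = 0"
  by (simp add: partial_def)

text \<open>A general field \<open>W\<close> is allowed because the curvature differentiates
  covariant derivatives of coordinate fields, whose components vary with the point.\<close>

lemma cov_deriv_along_coord_field:
  "cov_deriv \<alpha> (coord_field i) W p $ m =
     partial i (\<lambda>q. W q $ m) p + (\<Sum>n\<in>UNIV. W p $ n * Gamma_upper \<alpha> p m i n)"
proof -
  have "(\<Sum>l\<in>UNIV. \<Sum>j\<in>UNIV. coord_field i p $ l * W p $ j * Gamma_upper \<alpha> p m l j)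
      = (\<Sum>l\<in>UNIV. if i = l then \<Sum>j\<in>UNIV. W p $ j * Gamma_upper \<alpha> p m l j else 0)"
    by (intro sum.cong) (auto simp: coord_field_def axis_def)
  then show ?thesis
    by (simp add: cov_deriv_def dir_deriv_coord_field)
qed

text \<open>Coordinate fields have constant components, so their bracket vanishes. Each of the two
  iterated covariant derivatives splits into the derivative of a symbol and a quadratic
  term.\<close>

lemma curvature_coord_fields:
  "curvature \<alpha> (coord_field i) (coord_field j) (coord_field k) p $ m =
     partial i (\<lambda>q. Gamma_upper \<alpha> q m j k) p - partial j (\<lambda>q. Gamma_upper \<alpha> q m i k) p
     + (\<Sum>n\<in>UNIV. Gamma_upper \<alpha> p n j k * Gamma_upper \<alpha> p m i n
                  - Gamma_upper \<alpha> p n i k * Gamma_upper \<alpha> p m j n)"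
proof -
  have cov: "cov_deriv \<alpha> (coord_field i) (coord_field k) = (\<lambda>q. \<chi> m. Gamma_upper \<alpha> q m i k)" for i k
    by (rule ext) (rule cov_deriv_coord_field)
  have "lie_bracket (coord_field i) (coord_field j) p = 0"
    by (simp add: lie_bracket_def dir_deriv_coord_field vec_eq_iff) (simp add: coord_field_def)
  then have "cov_deriv \<alpha> (lie_bracket (coord_field i) (coord_field j)) (coord_field k) p = 0"
    by (simp add: cov_deriv_def dir_deriv_def vec_eq_iff)
  then show ?thesis
    by (simp add: curvature_def cov cov_deriv_along_coord_field sum_subtractf)
qed

text \<open>The index \<open>l\<close> is lowered by the metric and raised again by its inverse; as
  both are diagonal, the factors \<open>fisher_diag p $ l\<close> cancel termwise.\<close>

lemma alpha_ricci_eq_trace: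
  assumes p: "p \<in> orthant"
  shows "alpha_ricci \<alpha> p $ j $ k =
    (\<Sum>i\<in>UNIV. curvature \<alpha> (coord_field i) (coord_field j) (coord_field k) p $ i)"
proof -
  have lower: "curvature_comp \<alpha> p i j k l =
      fisher_diag p $ l * curvature \<alpha> (coord_field i) (coord_field j) (coord_field k) p $ l" for i l
    unfolding curvature_comp_def metric_form_def fisher_metric_eq[OF p]
    by (simp add: coord_field_def inner_vec_def matrix_vector_mult_def axis_def
        if_distrib[of "\<lambda>c. c * _"] if_distrib[of "\<lambda>c. _ * c"] mult.commute cong: if_cong)
  have "fisher_diag p $ i \<noteq> 0" for i
    using fisher_diag_pos[OF p, of i] by simp
  then show ?thesis
    by (simp add: alpha_ricci_def matrix_inv_fisher_metric[OF p] lower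
        if_distrib[of "\<lambda>c. c * _"] cong: if_cong)
qed

text \<open>\<open>Gamma_upper\<close> agrees with \<open>christoffel\<close> on the whole orthant,
  not only at \<open>p\<close>, so the derivatives at \<open>p\<close> agree as well.\<close>

lemma alpha_ricci_eq:
  fixes \<alpha> :: real
  assumes p: "p \<in> orthant"
  defines "\<Gamma> \<equiv> christoffel ((1 - \<alpha>) / 2)"
  shows "alpha_ricci \<alpha> p $ j $ k =
    (\<Sum>i\<in>UNIV. partial i (\<lambda>q. \<Gamma> q $ i $ j $ k) p - partial j (\<lambda>q. \<Gamma> q $ i $ i $ k) p
      + (\<Sum>n\<in>UNIV. \<Gamma> p $ n $ j $ k * \<Gamma> p $ i $ i $ n - \<Gamma> p $ n $ i $ k * \<Gamma> p $ i $ j $ n))"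
proof -
  have "partial l (\<lambda>q. Gamma_upper \<alpha> q m i j) p = partial l (\<lambda>q. \<Gamma> q $ m $ i $ j) p" for l m i j
    unfolding \<Gamma>_def by (rule partial_cong[OF p Gamma_upper_eq])
  then show ?thesis
    by (simp add: alpha_ricci_eq_trace[OF p] curvature_coord_fields Gamma_upper_eq[OF p] \<Gamma>_def)
qed

section \<open>Derivatives of the four shapes of nonconstant entries of
  \<open>christoffel\<close>\<close>

lemma partial_inverse_coord:
  assumes "p \<in> orthant"
  shows "partial i (\<lambda>q. u / q$k) p = - u * (axis i 1 :: real^4)$k / (p$k)\<^sup>2"
proof -
  have "p$k \<noteq> 0" using assms by (simp add: orthant_def less_imp_neq[symmetric])
  then show ?thesis
    by (intro partialI) (auto intro!: derivative_eq_intros simp: power2_eq_square)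
qed

lemma partial_inverse_sum:
  assumes "p \<in> orthant"
  shows "partial i (\<lambda>q. u / (q$1 + q$3)) p = - u * ((axis i 1 :: real^4)$1 + (axis i 1 :: real^4)$3) / (p$1 + p$3)\<^sup>2"
proof -
  have "p$1 + p$3 \<noteq> 0"
    using assms by (metis orthant_def mem_Collect_eq add_pos_pos less_irrefl)
  then show ?thesis
    by (intro partialI) (auto intro!: derivative_eq_intros simp: power2_eq_square)
qed

lemma partial_inverse_sum_plus:
  assumes "p \<in> orthant"
  shows "partial i (\<lambda>q. u / (q$1 + q$3) + v / q$k) p
    = - u * ((axis i 1 :: real^4)$1 + (axis i 1 :: real^4)$3) / (p$1 + p$3)\<^sup>2 - v * (axis i 1 :: real^4)$k / (p$k)\<^sup>2"
proof -
  have "p$1 + p$3 \<noteq> 0" "p$k \<noteq> 0"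
    using assms by (metis orthant_def mem_Collect_eq add_pos_pos less_irrefl)+
  then show ?thesis
    by (intro partialI) (auto intro!: derivative_eq_intros simp: power2_eq_square)
qed

lemma partial_product_quotient:
  assumes "p \<in> orthant"
  shows "partial i (\<lambda>q. u * (q$1 * q$3 / ((q$1 + q$3) * (q$k)\<^sup>2))) p
    = u * (((axis i 1 :: real^4)$1 * (p$3)\<^sup>2 + (axis i 1 :: real^4)$3 * (p$1)\<^sup>2) / ((p$1 + p$3)\<^sup>2 * (p$k)\<^sup>2)
      - 2 * p$1 * p$3 * (axis i 1 :: real^4)$k / ((p$1 + p$3) * (p$k)^3))"
proof -
  have "p$1 + p$3 \<noteq> 0" "p$k \<noteq> 0"
    using assms by (metis orthant_def mem_Collect_eq add_pos_pos less_irrefl)+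
  then show ?thesis
    by (intro partialI) (auto intro!: derivative_eq_intros
      simp: power2_eq_square power3_eq_cube divide_simps, simp add: algebra_simps)
qed

lemma alpha_ricci_freund:
  assumes pos: "\<alpha>\<^sub>1 > 0" "\<beta>\<^sub>1 > 0" "\<alpha>\<^sub>2 > 0" "\<beta>\<^sub>2 > 0"
  shows "alpha_ricci \<alpha> (vector [\<alpha>\<^sub>1, \<beta>\<^sub>1, \<alpha>\<^sub>2, \<beta>\<^sub>2]) = vector
     [vector [- (\<alpha>\<^sup>2 - 1) * \<alpha>\<^sub>2 / (2 * \<alpha>\<^sub>1 * (\<alpha>\<^sub>1 + \<alpha>\<^sub>2)\<^sup>2), 0,
              (\<alpha>\<^sup>2 - 1) / (2 * (\<alpha>\<^sub>1 + \<alpha>\<^sub>2)\<^sup>2), 0],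
      vector [0, - (\<alpha>\<^sup>2 - 1) * \<alpha>\<^sub>2 / (2 * (\<alpha>\<^sub>1 + \<alpha>\<^sub>2) * \<beta>\<^sub>1\<^sup>2), 0, 0],
      vector [(\<alpha>\<^sup>2 - 1) / (2 * (\<alpha>\<^sub>1 + \<alpha>\<^sub>2)\<^sup>2), 0,
              - (\<alpha>\<^sup>2 - 1) * \<alpha>\<^sub>1 / (2 * \<alpha>\<^sub>2 * (\<alpha>\<^sub>1 + \<alpha>\<^sub>2)\<^sup>2), 0],
      vector [0, 0, 0, - (\<alpha>\<^sup>2 - 1) * \<alpha>\<^sub>1 / (2 * (\<alpha>\<^sub>1 + \<alpha>\<^sub>2) * \<beta>\<^sub>2\<^sup>2)]]"
    (is "alpha_ricci \<alpha> ?p = ?R")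
proof -
  have p: "?p \<in> orthant" using pos by (simp add: orthant_def forall_4)
  have nz: "\<alpha>\<^sub>1 \<noteq> 0" "\<beta>\<^sub>1 \<noteq> 0" "\<alpha>\<^sub>2 \<noteq> 0" "\<beta>\<^sub>2 \<noteq> 0" "\<alpha>\<^sub>1 + \<alpha>\<^sub>2 \<noteq> 0"
    "2 * \<alpha>\<^sub>1 + 2 * \<alpha>\<^sub>2 \<noteq> 0"
    using pos by auto
  define \<epsilon> where "\<epsilon> = (1 - \<alpha>) / 2"
  \<comment> \<open>As \<alpha> = 1 - 2\<epsilon>, the claimed entries and the Christoffel symbols
    then depend on \<alpha> only through \<epsilon>.\<close>
  have \<epsilon>: "\<alpha>\<^sup>2 - 1 = 4 * (\<epsilon>\<^sup>2 - \<epsilon>)"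
    by (simp add: \<epsilon>_def field_simps power2_eq_square)
  have "\<forall>j k. alpha_ricci \<alpha> ?p $ j $ k = ?R $ j $ k"
    unfolding forall_4 alpha_ricci_eq[OF p] \<epsilon> \<epsilon>_def[symmetric] christoffel_def Let_def sum_4
    by (intro conjI;
      simp only: vector_4 zero_index partial_const partial_inverse_coord[OF p]
        partial_inverse_sum[OF p] partial_inverse_sum_plus[OF p] partial_product_quotient[OF p];
      simp add: axis_def;
      simp add: nz divide_simps;
      simp add: algebra_simps power2_eq_square power3_eq_cube)
  then show ?thesis by (simp add: vec_eq_iff)
qed


section \<open>Eigenvalues\<close>

text \<open>Laplace expansion along the first row. The Leibniz sum is split index by index, each
  permutation being a transposition composed with a permutation of the remaining indices.\<close>

lemma det_4:
  "det (A::'a::comm_ring_1^4^4) =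
    A$1$1 * (A$2$2 * (A$3$3 * A$4$4 - A$3$4 * A$4$3) - A$2$3 * (A$3$2 * A$4$4 - A$3$4 * A$4$2)
             + A$2$4 * (A$3$2 * A$4$3 - A$3$3 * A$4$2))
    - A$1$2 * (A$2$1 * (A$3$3 * A$4$4 - A$3$4 * A$4$3) - A$2$3 * (A$3$1 * A$4$4 - A$3$4 * A$4$1)
             + A$2$4 * (A$3$1 * A$4$3 - A$3$3 * A$4$1))
    + A$1$3 * (A$2$1 * (A$3$2 * A$4$4 - A$3$4 * A$4$2) - A$2$2 * (A$3$1 * A$4$4 - A$3$4 * A$4$1)
             + A$2$4 * (A$3$1 * A$4$2 - A$3$2 * A$4$1))
    - A$1$4 * (A$2$1 * (A$3$2 * A$4$3 - A$3$3 * A$4$2) - A$2$2 * (A$3$1 * A$4$3 - A$3$3 * A$4$1)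
             + A$2$3 * (A$3$1 * A$4$2 - A$3$2 * A$4$1))"
proof -
  have f: "finite {2::4, 3, 4}" "1 \<notin> {2::4, 3, 4}" "finite {3::4, 4}" "2 \<notin> {3::4, 4}"
    "finite {4::4}" "3 \<notin> {4::4}"
    by auto
  show ?thesis
    unfolding det_def UNIV_4
    unfolding sum_over_permutations_insert[OF f(1,2)]
    unfolding sum_over_permutations_insert[OF f(3,4)]
    unfolding sum_over_permutations_insert[OF f(5,6)]
    unfolding permutes_sing
    by (simp add: sign_swap_id permutation_swap_id permutation_compose sign_compose sign_id swap_id_eq
        algebra_simps)
qed

text \<open>
  The block on the coordinates 1 and 3 is singular, so it contributes the roots \<open>0\<close> and its
  trace \<open>r + t\<close>.
\<close>

lemma char_poly_block:
  fixes r s t \<mu>\<^sub>3 \<mu>\<^sub>4 :: real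
  assumes "r * t = s * s"
  defines "R \<equiv> vector [vector [r, 0, s, 0], vector [0, \<mu>\<^sub>3, 0, 0],
                        vector [s, 0, t, 0], vector [0, 0, 0, \<mu>\<^sub>4]] :: real^4^4"
  shows "char_poly R = [:0, 1:] * [:- (r + t), 1:] * [:- \<mu>\<^sub>3, 1:] * [:- \<mu>\<^sub>4, 1:]"
proof -
  \<comment> \<open>The constant terms \<open>r * t\<close> and \<open>s * s\<close> cancel, which
    leaves a quadratic with roots \<open>0\<close> and \<open>r + t\<close>.\<close>
  have "[:- r, 1:] * [:- t, 1:] - [:- s:] * [:- s:] = [:0, 1:] * [:- (r + t), 1:]"
    using assms(1) by (simp add: algebra_simps)
  moreover have "char_poly R = ([:- r, 1:] * [:- t, 1:] - [:- s:] * [:- s:]) * [:- \<mu>\<^sub>3, 1:] * [:- \<mu>\<^sub>4, 1:]"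
    unfolding char_poly_def R_def det_4 by (simp add: mat_def algebra_simps)
  ultimately show ?thesis by (simp only:)
qed

section \<open>Eigenvectors and spectrum of the block matrix\<close>

lemma matrix_vector_mult_4:
  fixes A :: "real^4^4"
  shows "(A *v x) $ i = A$i$1 * x$1 + A$i$2 * x$2 + A$i$3 * x$3 + A$i$4 * x$4"
  by (simp add: matrix_vector_mult_def sum_4)

text \<open>A vector supported on the coordinates 1 and 3 meets only the 2 by 2 block;
  \<open>z \<noteq> 0\<close> makes it nonzero.\<close>

lemma eigenvector_block:
  fixes r s t \<mu>\<^sub>3 \<mu>\<^sub>4 :: real
  assumes "r * x + s * z = c * x" "s * x + t * z = c * z" "z \<noteq> 0"
  shows "eigenvector (vector [vector [r, 0, s, 0], vector [0, \<mu>\<^sub>3, 0, 0],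
                              vector [s, 0, t, 0], vector [0, 0, 0, \<mu>\<^sub>4]] :: real^4^4)
           (vector [x, 0, z, 0]) c"
  unfolding eigenvector_def vec_eq_iff forall_4
  by (simp add: matrix_vector_mult_4 assms)

text \<open>Some coordinate of an eigenvector is nonzero: the second or fourth forces
  \<open>\<mu>\<^sub>3\<close> or \<open>\<mu>\<^sub>4\<close>, the first or third an eigenvalue of
  the 2 by 2 block.\<close>

lemma eigenvalue_block:
  fixes r s t \<mu>\<^sub>3 \<mu>\<^sub>4 :: real
  assumes "r * t = s * s"
  defines "R \<equiv> vector [vector [r, 0, s, 0], vector [0, \<mu>\<^sub>3, 0, 0],
                        vector [s, 0, t, 0], vector [0, 0, 0, \<mu>\<^sub>4]] :: real^4^4"
  assumes "eigenvalue R c"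
  shows "c \<in> {0, r + t, \<mu>\<^sub>3, \<mu>\<^sub>4}"
proof -
  obtain v where v: "v \<noteq> 0" "R *v v = c *\<^sub>R v"
    using assms(3) by (auto simp: eigenvalue_def eigenvector_def)
  have eq: "r * v$1 + s * v$3 = c * v$1" "\<mu>\<^sub>3 * v$2 = c * v$2" "s * v$1 + t * v$3 = c * v$3" "\<mu>\<^sub>4 * v$4 = c * v$4"
    using v(2) by (simp_all add: vec_eq_iff forall_4 matrix_vector_mult_4 R_def)
  \<comment> \<open>Cayley-Hamilton for the singular block: its square is \<open>r + t\<close> times
    itself, applied here to \<open>(v$1, v$3)\<close>.\<close>
  have "c * (c - (r + t)) * v$1 = 0" "c * (c - (r + t)) * v$3 = 0"
    using eq(1,3) assms(1) by algebra+
  moreover have "v$1 \<noteq> 0 \<or> v$2 \<noteq> 0 \<or> v$3 \<noteq> 0 \<or> v$4 \<noteq> 0"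
    using v(1) by (auto simp: vec_eq_iff forall_4)
  ultimately show ?thesis using eq(2,4) by auto
qed

text \<open>The set of eigenvalues forgets multiplicities, which do occur, for instance at \<alpha>
  = 1, where \<open>R\<close> vanishes; the characteristic polynomial records them.\<close>

theorem proposition1p5:
  fixes \<alpha> \<alpha>\<^sub>1 \<beta>\<^sub>1 \<alpha>\<^sub>2 \<beta>\<^sub>2 :: real
    and R :: "real^4^4"
    and \<mu>\<^sub>2 \<mu>\<^sub>3 \<mu>\<^sub>4 :: real
  assumes "\<alpha>\<^sub>1 > 0" "\<beta>\<^sub>1 > 0" "\<alpha>\<^sub>2 > 0" "\<beta>\<^sub>2 > 0"
  defines "R \<equiv> alpha_ricci \<alpha> (vector [\<alpha>\<^sub>1, \<beta>\<^sub>1, \<alpha>\<^sub>2, \<beta>\<^sub>2])"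
    and "\<mu>\<^sub>2 \<equiv> (\<alpha>\<^sup>2 - 1) * (1 / (\<alpha>\<^sub>1 + \<alpha>\<^sub>2)\<^sup>2 - 1 / (2 * \<alpha>\<^sub>1 * \<alpha>\<^sub>2))"
    and "\<mu>\<^sub>3 \<equiv> (\<alpha>\<^sup>2 - 1) * (- \<alpha>\<^sub>2 / (2 * (\<alpha>\<^sub>1 + \<alpha>\<^sub>2) * \<beta>\<^sub>1\<^sup>2))"
    and "\<mu>\<^sub>4 \<equiv> (\<alpha>\<^sup>2 - 1) * (- \<alpha>\<^sub>1 / (2 * (\<alpha>\<^sub>1 + \<alpha>\<^sub>2) * \<beta>\<^sub>2\<^sup>2))"
  shows "R = vector
     [vector [- (\<alpha>\<^sup>2 - 1) * \<alpha>\<^sub>2 / (2 * \<alpha>\<^sub>1 * (\<alpha>\<^sub>1 + \<alpha>\<^sub>2)\<^sup>2), 0,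
              (\<alpha>\<^sup>2 - 1) / (2 * (\<alpha>\<^sub>1 + \<alpha>\<^sub>2)\<^sup>2), 0],
      vector [0, - (\<alpha>\<^sup>2 - 1) * \<alpha>\<^sub>2 / (2 * (\<alpha>\<^sub>1 + \<alpha>\<^sub>2) * \<beta>\<^sub>1\<^sup>2), 0, 0],
      vector [(\<alpha>\<^sup>2 - 1) / (2 * (\<alpha>\<^sub>1 + \<alpha>\<^sub>2)\<^sup>2), 0,
              - (\<alpha>\<^sup>2 - 1) * \<alpha>\<^sub>1 / (2 * \<alpha>\<^sub>2 * (\<alpha>\<^sub>1 + \<alpha>\<^sub>2)\<^sup>2), 0],
      vector [0, 0, 0, - (\<alpha>\<^sup>2 - 1) * \<alpha>\<^sub>1 / (2 * (\<alpha>\<^sub>1 + \<alpha>\<^sub>2) * \<beta>\<^sub>2\<^sup>2)]]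
    \<and> {c. eigenvalue R c} = {0, \<mu>\<^sub>2, \<mu>\<^sub>3, \<mu>\<^sub>4}
    \<and> char_poly R = [:0, 1:] * [:- \<mu>\<^sub>2, 1:] * [:- \<mu>\<^sub>3, 1:] * [:- \<mu>\<^sub>4, 1:]
    \<and> eigenvector R (vector [\<alpha>\<^sub>1 / \<alpha>\<^sub>2, 0, 1, 0]) 0
    \<and> eigenvector R (vector [- \<alpha>\<^sub>2 / \<alpha>\<^sub>1, 0, 1, 0]) \<mu>\<^sub>2
    \<and> eigenvector R (vector [0, 1, 0, 0]) \<mu>\<^sub>3
    \<and> eigenvector R (vector [0, 0, 0, 1]) \<mu>\<^sub>4"
proof -
  define r where "r = - (\<alpha>\<^sup>2 - 1) * \<alpha>\<^sub>2 / (2 * \<alpha>\<^sub>1 * (\<alpha>\<^sub>1 + \<alpha>\<^sub>2)\<^sup>2)"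
  define s where "s = (\<alpha>\<^sup>2 - 1) / (2 * (\<alpha>\<^sub>1 + \<alpha>\<^sub>2)\<^sup>2)"
  define t where "t = - (\<alpha>\<^sup>2 - 1) * \<alpha>\<^sub>1 / (2 * \<alpha>\<^sub>2 * (\<alpha>\<^sub>1 + \<alpha>\<^sub>2)\<^sup>2)"
  have nz: "\<alpha>\<^sub>1 \<noteq> 0" "\<alpha>\<^sub>2 \<noteq> 0" "\<alpha>\<^sub>1 + \<alpha>\<^sub>2 \<noteq> 0"
    using assms(1-4) by auto
  have \<mu>\<^sub>3: "- (\<alpha>\<^sup>2 - 1) * \<alpha>\<^sub>2 / (2 * (\<alpha>\<^sub>1 + \<alpha>\<^sub>2) * \<beta>\<^sub>1\<^sup>2) = \<mu>\<^sub>3"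
    and \<mu>\<^sub>4: "- (\<alpha>\<^sup>2 - 1) * \<alpha>\<^sub>1 / (2 * (\<alpha>\<^sub>1 + \<alpha>\<^sub>2) * \<beta>\<^sub>2\<^sup>2) = \<mu>\<^sub>4"
    by (simp_all only: \<mu>\<^sub>3_def \<mu>\<^sub>4_def times_divide_eq_right mult_minus_left mult_minus_right)
  have R: "R = vector [vector [r, 0, s, 0], vector [0, \<mu>\<^sub>3, 0, 0],
                       vector [s, 0, t, 0], vector [0, 0, 0, \<mu>\<^sub>4]]"
    unfolding R_def r_def s_def t_def \<mu>\<^sub>3[symmetric] \<mu>\<^sub>4[symmetric]
    by (rule alpha_ricci_freund[OF assms(1-4)])
  \<comment> \<open>The identities \<open>det\<close>, \<open>ker\<close> and \<open>im\<close> hold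
    for any nonzero value in place of this square, so it is kept atomic there.\<close>
  define S where "S = (\<alpha>\<^sub>1 + \<alpha>\<^sub>2)\<^sup>2"
  have S: "S \<noteq> 0" using nz by (simp add: S_def)
  have det: "r * t = s * s"
    unfolding r_def s_def t_def S_def[symmetric] using nz S
    by (simp add: divide_simps) (simp add: algebra_simps)
  \<comment> \<open>Here the square matters:
    \<open>\<alpha>\<^sub>1\<^sup>2 + \<alpha>\<^sub>2\<^sup>2\<close> is \<open>(\<alpha>\<^sub>1 +
    \<alpha>\<^sub>2)\<^sup>2 - 2 * \<alpha>\<^sub>1 * \<alpha>\<^sub>2\<close>.\<close>
  have tr: "r + t = \<mu>\<^sub>2"
    unfolding r_def t_def \<mu>\<^sub>2_def using nz
    by (simp add: divide_simps) (simp add: algebra_simps power2_eq_square)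
  \<comment> \<open>\<open>ker\<close> exhibits a kernel vector of the block. By \<open>im\<close>
    both columns of the block are multiples of
    \<open>(- \<alpha>\<^sub>2 / \<alpha>\<^sub>1, 1)\<close>, so the block acts on this vector by
    its trace \<open>r + t\<close>.\<close>
  have ker: "r * (\<alpha>\<^sub>1 / \<alpha>\<^sub>2) + s = 0" "s * (\<alpha>\<^sub>1 / \<alpha>\<^sub>2) + t = 0"
    and im: "r = - s * (\<alpha>\<^sub>2 / \<alpha>\<^sub>1)" "s = - t * (\<alpha>\<^sub>2 / \<alpha>\<^sub>1)"
    unfolding r_def s_def t_def S_def[symmetric] using nz S
    by (simp add: divide_simps; simp add: algebra_simps)+
  have v\<^sub>1: "eigenvector R (vector [\<alpha>\<^sub>1 / \<alpha>\<^sub>2, 0, 1, 0]) 0"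
    unfolding R by (rule eigenvector_block)
      (simp_all only: mult_1_right mult_zero_left ker one_neq_zero not_False_eq_True)
  have v\<^sub>2: "eigenvector R (vector [- \<alpha>\<^sub>2 / \<alpha>\<^sub>1, 0, 1, 0]) \<mu>\<^sub>2"
    unfolding R
  proof (rule eigenvector_block)
    show "r * (- \<alpha>\<^sub>2 / \<alpha>\<^sub>1) + s * 1 = \<mu>\<^sub>2 * (- \<alpha>\<^sub>2 / \<alpha>\<^sub>1)"
      unfolding tr[symmetric] by (subst im(2)) (simp add: distrib_right add_divide_distrib)
    show "s * (- \<alpha>\<^sub>2 / \<alpha>\<^sub>1) + t * 1 = \<mu>\<^sub>2 * 1"
      unfolding tr[symmetric] by (subst im(1)) simp
  qed simp
  have v\<^sub>3: "eigenvector R (vector [0, 1, 0, 0]) \<mu>\<^sub>3"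
    and v\<^sub>4: "eigenvector R (vector [0, 0, 0, 1]) \<mu>\<^sub>4"
    unfolding R eigenvector_def vec_eq_iff forall_4 by (simp_all add: matrix_vector_mult_4)
  have "eigenvalue R 0" "eigenvalue R \<mu>\<^sub>2" "eigenvalue R \<mu>\<^sub>3" "eigenvalue R \<mu>\<^sub>4"
    unfolding eigenvalue_def by (rule exI, rule v\<^sub>1 v\<^sub>2 v\<^sub>3 v\<^sub>4)+
  moreover have "c \<in> {0, \<mu>\<^sub>2, \<mu>\<^sub>3, \<mu>\<^sub>4}" if "eigenvalue R c" for c
    using eigenvalue_block[OF det that[unfolded R]] unfolding tr .
  ultimately have spec: "{c. eigenvalue R c} = {0, \<mu>\<^sub>2, \<mu>\<^sub>3, \<mu>\<^sub>4}"
    by (intro subset_antisym subsetI) (simp_all only: mem_Collect_eq, auto)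
  have char: "char_poly R = [:0, 1:] * [:- \<mu>\<^sub>2, 1:] * [:- \<mu>\<^sub>3, 1:] * [:- \<mu>\<^sub>4, 1:]"
    using char_poly_block[OF det, of \<mu>\<^sub>3 \<mu>\<^sub>4] unfolding R tr .
  show ?thesis
    by (intro conjI spec char v\<^sub>1 v\<^sub>2 v\<^sub>3 v\<^sub>4) (unfold R_def, rule alpha_ricci_freund[OF assms(1-4)])
qed

end
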